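(* Let $\mathbb{T}^n$ be the flat $n$-torus with canonical coordinates $x_i\in\mathbb{R}/\mathbb{Z}$, and let $\beta:=a_1\,\mathrm{d}x_1+\cdots+a_n\,\mathrm{d}x_n$ for some fixed $a_i\in\mathbb{R}$. The standard Lee flow of $\mathcal{S}^{\mathrm{conf}}_\beta(T^1\mathbb{T}^n)$ does not have any periodic orbit if and only if the family $(1,a_1,\ldots,a_n)$ is rationally independent (i.e. linearly independent over $\mathbb{Q}$).
   Context: For a closed 1-form $\eta$ put $\mathrm{d}_\eta\alpha:=\mathrm{d}\alpha-\eta\wedge\alpha$. A conformal symplectic manifold is an even-dimensional manifold with a closed 1-form $\eta$ (Lee form) and a non-degenerate 2-form $\omega$ with $\mathrm{d}_\eta\omega=0$. Its Lee vector field $L$ (the Hamiltonian vector field of $H\equiv1$) is defined by $\iota_L\omega=\mathrm{d}_\eta 1=-\eta$; the Lee flow is the flow of $L$. For a manifold $Y$ with contact form $\alpha$ and a closed 1-form $\beta$ on $Y$, the $\beta$-twisted conformal symplectization $\mathcal{S}^{\mathrm{conf}}_\beta(Y,\alpha)$ is $Y\times S^1$, $S^1=\mathbb{R}/\mathbb{Z}$, with $\eta=\pi^*\beta-\mathrm{d}\theta$ and $\omega=-\mathrm{d}_\eta(\pi^*\alpha)$, where $\pi:Y\times S^1\to Y$ and $\theta:Y\times S^1\to S^1$ are the projections. The standard Lee flow is the Lee flow for this choice of $(\eta,\omega)$. Here $Y=T^1\mathbb{T}^n\simeq\mathbb{T}^n\times\mathbb{S}^{n-1}$ is the unit tangent bundle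 for the flat metric, with its usual contact form $\alpha_{(x,v)}=\sum_i v_i\,\mathrm{d}x_i$ (whose Reeb flow is the geodesic flow), and $\beta$ also denotes its pull-back to $T^1\mathbb{T}^n$. *)

theory Defs
  imports "HOL-Analysis.Analysis"
begin

text \<open>The circle \<open>\<real>/\<int>\<close>.\<close>

quotient_type circle = real / "\<lambda>x y. x - y \<in> \<int>"
proof (rule equivpI)
  show "reflp (\<lambda>x y::real. x - y \<in> \<int>)"
    by (simp add: reflp_def)
  show "symp (\<lambda>x y::real. x - y \<in> \<int>)"
    by (metis (no_types, lifting) Ints_minus minus_diff_eq sympI)
  show "transp (\<lambda>x y::real. x - y \<in> \<int>)"
  proof (rule transpI)
    fix x y z :: real
    assume "x - y \<in> \<int>" "y - z \<in> \<int>"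
    then have "(x - y) + (y - z) \<in> \<int>" by (rule Ints_add)
    then show "x - z \<in> \<int>" by simp
  qed
qed

lift_definition circle_shift :: "circle \<Rightarrow> real \<Rightarrow> circle" is "\<lambda>x h. x + h"
  by simp

text \<open>
  A manifold is given here as a submanifold \<open>points\<close> of an ambient parallelised manifold of
  type \<open>'p\<close> (a product of copies of \<open>\<real>\<close> and \<open>\<real>/\<int>\<close>). The map \<open>shift p\<close> sends a
  coordinate increment in \<open>'e\<close> to an ambient point; near \<open>0\<close> it is the inverse of the
  canonical chart at \<open>p\<close>, so ambient tangent vectors are elements of \<open>'e\<close>, and
  \<open>tangent p\<close> is the tangent space of the submanifold at \<open>p\<close>.
  Differential forms are written as restrictions of ambient forms; since pull-back commutes with
  the exterior derivative, evaluating the ambient derivative on tangent vectors of the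
  submanifold gives the exterior derivative on the submanifold.
\<close>

record ('p, 'e) manifold =
  points :: "'p set"
  tangent :: "'p \<Rightarrow> 'e set"
  shift :: "'p \<Rightarrow> 'e \<Rightarrow> 'p"

type_synonym ('p, 'e) form1 = "'p \<Rightarrow> 'e \<Rightarrow> real"
type_synonym ('p, 'e) form2 = "'p \<Rightarrow> 'e \<Rightarrow> 'e \<Rightarrow> real"

definition partial ::
  "('p, 'e::real_normed_vector) manifold \<Rightarrow> ('p \<Rightarrow> real) \<Rightarrow> 'p \<Rightarrow> 'e \<Rightarrow> real" where
  "partial M f p X = frechet_derivative (\<lambda>h. f (shift M p h)) (at 0) X"

definition ext_d0 ::
  "('p, 'e::real_normed_vector) manifold \<Rightarrow> ('p \<Rightarrow> real) \<Rightarrow> ('p, 'e) form1" where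
  "ext_d0 M f = (\<lambda>p X. partial M f p X)"

text \<open>
  Here \<open>X\<close> and \<open>Y\<close> are extended to vector fields with constant coordinates, so the bracket
  term of the invariant formula vanishes.
\<close>

definition ext_d1 ::
  "('p, 'e::real_normed_vector) manifold \<Rightarrow> ('p, 'e) form1 \<Rightarrow> ('p, 'e) form2" where
  "ext_d1 M \<alpha> = (\<lambda>p X Y. partial M (\<lambda>q. \<alpha> q Y) p X - partial M (\<lambda>q. \<alpha> q X) p Y)"

definition wedge :: "('p, 'e) form1 \<Rightarrow> ('p, 'e) form1 \<Rightarrow> ('p, 'e) form2" where
  "wedge \<eta> \<alpha> = (\<lambda>p X Y. \<eta> p X * \<alpha> p Y - \<eta> p Y * \<alpha> p X)"

definition twisted_d0 ::
  "('p, 'e::real_normed_vector) manifold \<Rightarrow> ('p, 'e) form1 \<Rightarrow> ('p \<Rightarrow> real) \<Rightarrow> ('p, 'e) form1" where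
  "twisted_d0 M \<eta> f = (\<lambda>p X. ext_d0 M f p X - f p * \<eta> p X)"

definition twisted_d1 ::
  "('p, 'e::real_normed_vector) manifold \<Rightarrow> ('p, 'e) form1 \<Rightarrow> ('p, 'e) form1 \<Rightarrow> ('p, 'e) form2" where
  "twisted_d1 M \<eta> \<alpha> = (\<lambda>p X Y. ext_d1 M \<alpha> p X Y - wedge \<eta> \<alpha> p X Y)"

definition hamiltonian_field ::
  "('p, 'e::real_normed_vector) manifold \<Rightarrow> ('p, 'e) form1 \<Rightarrow> ('p, 'e) form2 \<Rightarrow>
    ('p \<Rightarrow> real) \<Rightarrow> 'p \<Rightarrow> 'e" where
  "hamiltonian_field M \<eta> \<omega> H p =
    (THE X. X \<in> tangent M p \<and> (\<forall>Y \<in> tangent M p. \<omega> p X Y = twisted_d0 M \<eta> H p Y))"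

definition lee_field ::
  "('p, 'e::real_normed_vector) manifold \<Rightarrow> ('p, 'e) form1 \<Rightarrow> ('p, 'e) form2 \<Rightarrow> 'p \<Rightarrow> 'e" where
  "lee_field M \<eta> \<omega> = hamiltonian_field M \<eta> \<omega> (\<lambda>_. 1)"

definition has_velocity ::
  "('p, 'e::real_normed_vector) manifold \<Rightarrow> (real \<Rightarrow> 'p) \<Rightarrow> 'e \<Rightarrow> real \<Rightarrow> bool" where
  "has_velocity M \<gamma> V t \<longleftrightarrow>
    (\<exists>c. c t = 0 \<and> (c has_vector_derivative V) (at t) \<and>
         (\<forall>\<^sub>F s in nhds t. \<gamma> s = shift M (\<gamma> t) (c s)))"

definition integral_curve ::
  "('p, 'e::real_normed_vector) manifold \<Rightarrow> ('p \<Rightarrow> 'e) \<Rightarrow> (real \<Rightarrow> 'p) \<Rightarrow> bool" where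
  "integral_curve M X \<gamma> \<longleftrightarrow> (\<forall>t. \<gamma> t \<in> points M \<and> has_velocity M \<gamma> (X (\<gamma> t)) t)"

text \<open>
  Orbits of the flow are maximal integral curves; a periodic one is defined on all of \<open>\<real>\<close>.
  Constant curves are not excluded separately: a Lee field with nowhere vanishing Lee form
  (such as the pull-back of \<open>\<beta>\<close> minus \<open>d\<theta>\<close>) has no zeros.
\<close>

definition flow_has_periodic_orbit ::
  "('p, 'e::real_normed_vector) manifold \<Rightarrow> ('p \<Rightarrow> 'e) \<Rightarrow> bool" where
  "flow_has_periodic_orbit M X \<longleftrightarrow>
    (\<exists>\<gamma> T. integral_curve M X \<gamma> \<and> T > 0 \<and> (\<forall>t. \<gamma> (t + T) = \<gamma> t))"

definition conf_manifold :: "('p, 'e) manifold \<Rightarrow> ('p \<times> circle, 'e \<times> real) manifold" where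
  "conf_manifold Y =
    \<lparr> points = points Y \<times> UNIV,
      tangent = (\<lambda>(y, \<theta>). tangent Y y \<times> UNIV),
      shift = (\<lambda>(y, \<theta>) (h, s). (shift Y y h, circle_shift \<theta> s)) \<rparr>"

definition conf_pullback :: "('p, 'e) form1 \<Rightarrow> ('p \<times> circle, 'e \<times> real) form1" where
  "conf_pullback \<alpha> = (\<lambda>p X. \<alpha> (fst p) (fst X))"

definition d_theta :: "('p \<times> circle, 'e \<times> real) form1" where
  "d_theta = (\<lambda>p X. snd X)"

definition conf_lee_form :: "('p, 'e) form1 \<Rightarrow> ('p \<times> circle, 'e \<times> real) form1" where
  "conf_lee_form \<beta> = (\<lambda>p X. conf_pullback \<beta> p X - d_theta p X)"

definition conf_symplectic_form ::
  "('p, 'e::real_normed_vector) manifold \<Rightarrow> ('p, 'e) form1 \<Rightarrow> ('p, 'e) form1 \<Rightarrow>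
    ('p \<times> circle, 'e \<times> real) form2" where
  "conf_symplectic_form Y \<alpha> \<beta> =
    (\<lambda>p X Z. - twisted_d1 (conf_manifold Y) (conf_lee_form \<beta>) (conf_pullback \<alpha>) p X Z)"

definition standard_lee_field ::
  "('p, 'e::real_normed_vector) manifold \<Rightarrow> ('p, 'e) form1 \<Rightarrow> ('p, 'e) form1 \<Rightarrow>
    'p \<times> circle \<Rightarrow> 'e \<times> real" where
  "standard_lee_field Y \<alpha> \<beta> =
    lee_field (conf_manifold Y) (conf_lee_form \<beta>) (conf_symplectic_form Y \<alpha> \<beta>)"

definition unit_tangent_torus ::
  "((circle ^ 'n) \<times> (real ^ 'n), (real ^ 'n) \<times> (real ^ 'n)) manifold" where
  "unit_tangent_torus =
    \<lparr> points = UNIV \<times> sphere 0 1,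
      tangent = (\<lambda>(x, v). {(\<xi>, w). v \<bullet> w = 0}),
      shift = (\<lambda>(x, v) (h, k). (\<chi> i. circle_shift (x $ i) (h $ i), v + k)) \<rparr>"

definition torus_contact_form ::
  "((circle ^ 'n) \<times> (real ^ 'n), (real ^ 'n) \<times> (real ^ 'n)) form1" where
  "torus_contact_form = (\<lambda>(x, v) (\<xi>, w). \<Sum>i\<in>UNIV. v $ i * \<xi> $ i)"

definition torus_constant_form ::
  "real ^ 'n \<Rightarrow> (circle ^ 'n, real ^ 'n) form1" where
  "torus_constant_form a = (\<lambda>x \<xi>. \<Sum>i\<in>UNIV. a $ i * \<xi> $ i)"

definition torus_pullback ::
  "(circle ^ 'n, real ^ 'n) form1 \<Rightarrow>
    ((circle ^ 'n) \<times> (real ^ 'n), (real ^ 'n) \<times> (real ^ 'n)) form1" where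
  "torus_pullback \<beta> = (\<lambda>(x, v) (\<xi>, w). \<beta> x \<xi>)"

definition rationally_independent :: "('i::finite \<Rightarrow> real) \<Rightarrow> bool" where
  "rationally_independent f \<longleftrightarrow>
    (\<forall>q :: 'i \<Rightarrow> rat. (\<Sum>i\<in>UNIV. of_rat (q i) * f i) = 0 \<longrightarrow> (\<forall>i. q i = 0))"

end

theory Submission imports Defs begin

text \<open>
  At a point \<open>((x, v), \<theta>)\<close> with \<open>norm v = 1\<close> the equation \<open>\<omega>(L, \<cdot>) = -\<eta>\<close> has the unique solution
  \<open>L = ((v, 0), a \<bullet> v)\<close>: the Lee field is the lift of the geodesic field (the Reeb field of \<open>\<alpha>\<close>)
  on which \<open>\<eta>\<close> vanishes. Hence \<open>v\<close> is constant along an orbit, and each angle, be it a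
  coordinate of \<open>x\<close> or \<open>\<theta>\<close>, turns at constant speed, namely at speed \<open>v $ i\<close> or \<open>a \<bullet> v\<close>.

  Such an orbit closes up after time \<open>T > 0\<close> exactly when \<open>T *\<^sub>R v\<close> is an integer vector and
  \<open>T * (a \<bullet> v)\<close> is an integer. Since \<open>v\<close> ranges over all unit vectors, \<open>m = T *\<^sub>R v\<close>
  ranges over all nonzero vectors, and a periodic orbit exists if and only if some nonzero
  integer vector \<open>m\<close> has \<open>a \<bullet> m \<in> \<int>\<close>. Clearing denominators, this is a nontrivial
  rational relation between \<open>1\<close> and the \<open>a $ i\<close>: in such a relation the coefficients of
  the \<open>a $ i\<close> cannot all vanish, since then that of \<open>1\<close> would vanish too.
\<close>

section \<open>The Lee field of the conformal symplectization of the torus\<close>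

lemma torus_contact_form_inner: "torus_contact_form (x, v) (\<xi>, w) = v \<bullet> \<xi>"
  by (simp add: torus_contact_form_def inner_vec_def)

lemma torus_constant_form_inner: "torus_constant_form a x \<xi> = a \<bullet> \<xi>"
  by (simp add: torus_constant_form_def inner_vec_def)

lemma partial_contact_form:
  fixes v \<xi> w \<xi>' w' :: "real ^ 'n"
  shows "partial (conf_manifold unit_tangent_torus) (\<lambda>q. conf_pullback torus_contact_form q ((\<xi>', w'), s'))
     ((x, v), \<theta>) ((\<xi>, w), s) = w \<bullet> \<xi>'"
proof -
  have eq: "(\<lambda>h. conf_pullback torus_contact_form
              (shift (conf_manifold unit_tangent_torus) ((x, v), \<theta>) h) ((\<xi>', w'), s'))
            = (\<lambda>h. (v + snd (fst h)) \<bullet> \<xi>')"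
    by (auto simp: conf_pullback_def conf_manifold_def unit_tangent_torus_def
        torus_contact_form_inner fun_eq_iff)
  have "((\<lambda>h::((real^'n) \<times> (real^'n)) \<times> real. (v + snd (fst h)) \<bullet> \<xi>')
          has_derivative (\<lambda>h. snd (fst h) \<bullet> \<xi>')) (at 0)"
    by (auto intro!: derivative_eq_intros)
  from frechet_derivative_at[OF this] show ?thesis
    unfolding partial_def eq by (metis fst_conv snd_conv)
qed

lemma conf_symplectic_form_torus:
  "conf_symplectic_form unit_tangent_torus torus_contact_form (torus_pullback (torus_constant_form a))
     ((x, v), \<theta>) ((\<xi>, w), s) ((\<xi>', w'), s')
   = w' \<bullet> \<xi> - w \<bullet> \<xi>' + (a \<bullet> \<xi> - s) * (v \<bullet> \<xi>') - (a \<bullet> \<xi>' - s') * (v \<bullet> \<xi>)"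
  unfolding conf_symplectic_form_def twisted_d1_def ext_d1_def partial_contact_form
  by (simp add: wedge_def conf_lee_form_def conf_pullback_def d_theta_def torus_pullback_def
      torus_constant_form_inner torus_contact_form_inner)

lemma twisted_differential_of_one:
  "twisted_d0 M \<eta> (\<lambda>_. 1) p Y = - \<eta> p Y"
  by (simp add: twisted_d0_def ext_d0_def partial_def)

text \<open>
  Testing \<open>\<omega>(L, \<cdot>) = -\<eta>\<close> on three families of tangent vectors determines \<open>L = ((\<xi>, w), s)\<close>: the
  circle direction gives \<open>v \<bullet> \<xi> = 1\<close>, the fibre directions give that \<open>\<xi>\<close> is parallel to \<open>v\<close>,
  and the torus directions give \<open>w = \<eta>(L) v\<close>, so that both sides vanish because \<open>w\<close> is
  orthogonal to \<open>v\<close>.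
\<close>

lemma standard_lee_field_torus:
  fixes a v :: "real ^ 'n"
  assumes v: "norm v = 1"
  shows "standard_lee_field unit_tangent_torus torus_contact_form
           (torus_pullback (torus_constant_form a)) ((x, v), \<theta>) = ((v, 0), a \<bullet> v)"
proof -
  let ?M = "conf_manifold (unit_tangent_torus ::
    ((circle ^ 'n) \<times> (real ^ 'n), (real ^ 'n) \<times> (real ^ 'n)) manifold)"
  let ?\<eta> = "conf_lee_form (torus_pullback (torus_constant_form a))
    :: ((circle ^ 'n) \<times> (real ^ 'n)) \<times> circle \<Rightarrow> _"
  let ?\<omega> = "conf_symplectic_form unit_tangent_torus torus_contact_form
    (torus_pullback (torus_constant_form a))"
  let ?p = "((x, v), \<theta>)"
  have vv: "v \<bullet> v = 1"
    using v by (simp add: dot_square_norm)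
  have tangent: "tangent ?M ?p = {((\<xi>, w), s). v \<bullet> w = 0}"
    by (auto simp: conf_manifold_def unit_tangent_torus_def)
  have eta: "?\<eta> ?p ((\<xi>, w), s) = a \<bullet> \<xi> - s" for \<xi> w s
    by (simp add: conf_lee_form_def conf_pullback_def d_theta_def torus_pullback_def
        torus_constant_form_inner)
  show ?thesis
    unfolding standard_lee_field_def lee_field_def hamiltonian_field_def twisted_differential_of_one
  proof (rule the_equality)
    show "((v, 0), a \<bullet> v) \<in> tangent ?M ?p \<and>
      (\<forall>Y\<in>tangent ?M ?p. ?\<omega> ?p ((v, 0), a \<bullet> v) Y = - ?\<eta> ?p Y)"
      unfolding tangent by (auto simp: conf_symplectic_form_torus eta vv inner_commute)
  next
    fix X assume X: "X \<in> tangent ?M ?p \<and> (\<forall>Y\<in>tangent ?M ?p. ?\<omega> ?p X Y = - ?\<eta> ?p Y)"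
    obtain \<xi> w s where X_eq: "X = ((\<xi>, w), s)" by (metis surj_pair)
    have vw: "v \<bullet> w = 0" using X unfolding tangent X_eq by auto
    have eq: "w' \<bullet> \<xi> - w \<bullet> \<xi>' + (a \<bullet> \<xi> - s) * (v \<bullet> \<xi>') - (a \<bullet> \<xi>' - s') * (v \<bullet> \<xi>) = s' - a \<bullet> \<xi>'"
      if "v \<bullet> w' = 0" for \<xi>' w' s'
    proof -
      have "((\<xi>', w'), s') \<in> tangent ?M ?p" unfolding tangent using that by simp
      with X have "?\<omega> ?p X ((\<xi>', w'), s') = - ?\<eta> ?p ((\<xi>', w'), s')" by blast
      then show ?thesis unfolding X_eq conf_symplectic_form_torus eta by simp
    qed
    have v\<xi>: "v \<bullet> \<xi> = 1" using eq[of 0 0 1] by simp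
    have "\<xi> = v"
    proof -
      have "v \<bullet> (\<xi> - v) = 0" by (simp add: inner_diff_right vv v\<xi>)
      moreover from eq[OF this, of 0 0] have "(\<xi> - v) \<bullet> \<xi> = 0" by simp
      ultimately have "(\<xi> - v) \<bullet> (\<xi> - v) = 0"
        by (simp add: inner_diff_right inner_commute)
      then show ?thesis by simp
    qed
    have w: "w \<bullet> \<xi>' = (a \<bullet> \<xi> - s) * (v \<bullet> \<xi>')" for \<xi>'
      using eq[of 0 \<xi>' 0] v\<xi> by simp
    have "s = a \<bullet> \<xi>" using w[of v] vv vw by (simp add: inner_commute)
    moreover from this w[of w] have "w = 0" by simp
    ultimately show "X = ((v, 0), a \<bullet> v)" using \<open>\<xi> = v\<close> X_eq by simp
  qed
qed

section \<open>Rotation at constant speed\<close>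

text \<open>
  Embedding the circle in the complex plane turns statements about lifts of a curve
  into calculus of complex-valued functions.
\<close>

lift_definition circle_exp :: "circle \<Rightarrow> complex" is "\<lambda>x. cis (2 * pi * x)"
proof -
  fix x y :: real
  assume "x - y \<in> \<int>"
  then obtain k where "x - y = of_int k" by (auto elim: Ints_cases)
  then have "2 * pi * x = 2 * pi * y + 2 * pi * of_int k" by (simp add: algebra_simps)
  then show "cis (2 * pi * x) = cis (2 * pi * y)"
    by (simp add: cis_mult[symmetric] cis_multiple_2pi)
qed

lemma circle_exp_shift: "circle_exp (circle_shift x h) = circle_exp x * cis (2 * pi * h)"
  by transfer (simp add: cis_mult ring_distribs)

lemma circle_exp_nonzero: "circle_exp x \<noteq> 0"
  by transfer simp

lemma circle_shift_shift: "circle_shift (circle_shift x h) k = circle_shift x (h + k)"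
  by transfer simp

lemma circle_shift_Ints: "k \<in> \<int> \<Longrightarrow> circle_shift x k = x"
  by transfer simp

lemma Ints_if_cis_eq_1:
  assumes "cis (2 * pi * r) = 1"
  shows "r \<in> \<int>"
proof -
  have "cos (2 * pi * r) = 1" using assms by (metis cis.sel(1) one_complex.sel(1))
  then obtain k :: int where "2 * pi * r = of_int k * 2 * pi" using cos_one_2pi_int by blast
  then have "r = of_int k" by simp
  then show ?thesis by simp
qed

lemma has_vector_derivative_eventually_eq:
  assumes "(f has_vector_derivative D) (at t)" and "\<forall>\<^sub>F s in nhds t. f s = g s"
  shows "(g has_vector_derivative D) (at t)"
proof -
  have "f t = g t" using assms(2) by (rule eventually_nhds_x_imp_x)
  then show ?thesis
    using assms has_vector_derivative_cong_ev[of UNIV f g t D] by simp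
qed

text \<open>
  Undoing the rotation makes the curve constant: if \<open>\<gamma>\<close> has speed \<open>\<kappa>\<close>, then \<open>circle_exp (\<gamma> t)\<close> times
  \<open>cis (- 2 * pi * \<kappa> * t)\<close> has derivative zero, so whenever \<open>\<gamma>\<close> is back at
  its starting point the compensating factor is back at \<open>1\<close>.
\<close>

lemma period_of_constant_speed_rotation:
  fixes \<gamma> :: "real \<Rightarrow> circle"
  assumes speed: "\<And>t. \<exists>c. c t = 0 \<and> (c has_vector_derivative \<kappa>) (at t) \<and>
      (\<forall>\<^sub>F s in nhds t. \<gamma> s = circle_shift (\<gamma> t) (c s))"
    and period: "\<gamma> T = \<gamma> 0"
  shows "T * \<kappa> \<in> \<int>"
proof -
  define F where "F t = circle_exp (\<gamma> t) * cis (- (2 * pi * \<kappa> * t))" for t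
  have "(F has_vector_derivative 0) (at t)" for t
  proof -
    obtain c where c: "c t = 0" "(c has_real_derivative \<kappa>) (at t)"
      and ev: "\<forall>\<^sub>F s in nhds t. \<gamma> s = circle_shift (\<gamma> t) (c s)"
      using speed[of t] by (auto simp: has_real_derivative_iff_has_vector_derivative)
    define u where "u s = 2 * pi * (c s - \<kappa> * s)" for s
    have "(u has_real_derivative 0) (at t)"
      unfolding u_def by (auto intro!: derivative_eq_intros c(2))
    then have "((\<lambda>s. Complex (cos (u s)) (sin (u s))) has_vector_derivative
        of_real (0::real)) (at t)"
      unfolding has_vector_derivative_complex_iff
      by (auto intro!: derivative_eq_intros)
    then have "((\<lambda>s. cis (u s)) has_vector_derivative 0) (at t)"
      by (simp add: cis.code)
    then have "((\<lambda>s. circle_exp (\<gamma> t) * cis (u s)) has_vector_derivative 0) (at t)"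
      by (auto intro!: derivative_eq_intros)
    moreover have "\<forall>\<^sub>F s in nhds t. circle_exp (\<gamma> t) * cis (u s) = F s"
      using ev by eventually_elim
        (simp add: F_def u_def circle_exp_shift cis_mult algebra_simps)
    ultimately show ?thesis
      by (rule has_vector_derivative_eventually_eq)
  qed
  then have "F T = F 0"
    using has_vector_derivative_zero_constant[of UNIV F] by (metis UNIV_I convex_UNIV)
  then have "cis (- (2 * pi * \<kappa> * T)) = 1"
    using period by (simp add: F_def circle_exp_nonzero)
  then have "cis (2 * pi * (- (\<kappa> * T))) = 1" by (simp add: algebra_simps)
  then have "- (\<kappa> * T) \<in> \<int>" by (rule Ints_if_cis_eq_1)
  then show ?thesis using Ints_minus by (fastforce simp: mult.commute)
qed

section \<open>Periodic orbits and integer vectors\<close>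

lemma shift_conf_torus:
  "shift (conf_manifold unit_tangent_torus) ((x, v), \<theta>) ((h, k), s)
   = (((\<chi> i. circle_shift (x $ i) (h $ i)), v + k), circle_shift \<theta> s)"
  by (simp add: conf_manifold_def unit_tangent_torus_def)

lemma periodic_orbit_imp_integer_vector:
  fixes a :: "real ^ 'n"
  assumes "flow_has_periodic_orbit (conf_manifold unit_tangent_torus)
     (standard_lee_field unit_tangent_torus torus_contact_form
        (torus_pullback (torus_constant_form a)))"
  shows "\<exists>m::real^'n. m \<noteq> 0 \<and> (\<forall>i. m $ i \<in> \<int>) \<and> a \<bullet> m \<in> \<int>"
proof -
  let ?L = "standard_lee_field unit_tangent_torus torus_contact_form
     (torus_pullback (torus_constant_form a))"
  let ?M = "conf_manifold (unit_tangent_torus ::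
    ((circle ^ 'n) \<times> (real ^ 'n), (real ^ 'n) \<times> (real ^ 'n)) manifold)"
  obtain \<gamma> T where curve: "integral_curve ?M ?L \<gamma>" and "T > 0" and period: "\<And>t. \<gamma> (t + T) = \<gamma> t"
    using assms unfolding flow_has_periodic_orbit_def by blast
  define x v \<theta> where "x t = fst (fst (\<gamma> t))" and "v t = snd (fst (\<gamma> t))" and "\<theta> t = snd (\<gamma> t)" for t
  have \<gamma>: "\<gamma> t = ((x t, v t), \<theta> t)" for t by (simp add: x_def v_def \<theta>_def)
  have unit: "norm (v t) = 1" for t
    using curve unfolding integral_curve_def
    by (auto simp: conf_manifold_def unit_tangent_torus_def \<gamma> dest!: spec[of _ t])
  have velocity: "\<exists>h k c. h t = 0 \<and> k t = 0 \<and> c t = 0 \<and>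
      (h has_vector_derivative v t) (at t) \<and> (k has_vector_derivative 0) (at t) \<and>
      (c has_vector_derivative (a \<bullet> v t)) (at t) \<and>
      (\<forall>\<^sub>F s in nhds t. x s = (\<chi> i. circle_shift (x t $ i) (h s $ i)) \<and> v s = v t + k s \<and>
         \<theta> s = circle_shift (\<theta> t) (c s))" for t
  proof -
    have "has_velocity ?M \<gamma> ((v t, 0), a \<bullet> v t) t"
      using curve unit[of t] unfolding integral_curve_def
      by (metis \<gamma> standard_lee_field_torus)
    then obtain C where C: "C t = 0" "(C has_vector_derivative ((v t, 0), a \<bullet> v t)) (at t)"
      and ev: "\<forall>\<^sub>F s in nhds t. \<gamma> s = shift ?M (\<gamma> t) (C s)"
      unfolding has_velocity_def by blast
    have "((\<lambda>s. fst (fst (C s))) has_vector_derivative v t) (at t)"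
      using bounded_linear.has_vector_derivative[OF bounded_linear_fst_comp[OF bounded_linear_fst] C(2)]
      by simp
    moreover have "((\<lambda>s. snd (fst (C s))) has_vector_derivative 0) (at t)"
      using bounded_linear.has_vector_derivative[OF bounded_linear_snd_comp[OF bounded_linear_fst] C(2)]
      by simp
    moreover have "((\<lambda>s. snd (C s)) has_vector_derivative (a \<bullet> v t)) (at t)"
      using bounded_linear.has_vector_derivative[OF bounded_linear_snd C(2)] by simp
    moreover have "\<forall>\<^sub>F s in nhds t. x s = (\<chi> i. circle_shift (x t $ i) (fst (fst (C s)) $ i)) \<and>
         v s = v t + snd (fst (C s)) \<and> \<theta> s = circle_shift (\<theta> t) (snd (C s))"
      using ev
    proof eventually_elim
      case (elim s)
      then show ?case
        unfolding \<gamma> using shift_conf_torus[of "x t" "v t" "\<theta> t" "fst (fst (C s))" "snd (fst (C s))" "snd (C s)"]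
        by simp
    qed
    ultimately show ?thesis using C(1)
      by (intro exI[of _ "\<lambda>s. fst (fst (C s))"] exI[of _ "\<lambda>s. snd (fst (C s))"]
          exI[of _ "\<lambda>s. snd (C s)"]) simp
  qed
  have "(v has_vector_derivative 0) (at t)" for t
  proof -
    obtain k where k: "k t = 0" "(k has_vector_derivative 0) (at t)"
      and ev: "\<forall>\<^sub>F s in nhds t. v s = v t + k s"
      using velocity[of t] by (auto simp: eventually_conj_iff)
    have "((\<lambda>s. v t + k s) has_vector_derivative 0) (at t)"
      using k(2) by (auto intro!: derivative_eq_intros)
    moreover have "\<forall>\<^sub>F s in nhds t. v t + k s = v s"
      using ev by eventually_elim simp
    ultimately show ?thesis
      by (rule has_vector_derivative_eventually_eq)
  qed
  then have const: "v t = v 0" for t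
    using has_vector_derivative_zero_constant[of UNIV v] by (metis UNIV_I convex_UNIV)
  have "T * v 0 $ i \<in> \<int>" for i
  proof (rule period_of_constant_speed_rotation[where \<gamma> = "\<lambda>t. x t $ i"])
    show "x T $ i = x 0 $ i" using period[of 0] by (simp add: x_def)
    fix t
    obtain h where h: "h t = 0" "(h has_vector_derivative v 0) (at t)"
      "\<forall>\<^sub>F s in nhds t. x s = (\<chi> i. circle_shift (x t $ i) (h s $ i))"
      using velocity[of t] by (auto simp: eventually_conj_iff const[of t])
    then have "((\<lambda>s. h s $ i) has_vector_derivative v 0 $ i) (at t)"
      using bounded_linear.has_vector_derivative[OF bounded_linear_vec_nth] by blast
    moreover have "\<forall>\<^sub>F s in nhds t. x s $ i = circle_shift (x t $ i) (h s $ i)"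
      using h(3) by eventually_elim simp
    ultimately show "\<exists>c. c t = 0 \<and> (c has_vector_derivative v 0 $ i) (at t) \<and>
        (\<forall>\<^sub>F s in nhds t. x s $ i = circle_shift (x t $ i) (c s))"
      using h(1) by (intro exI[of _ "\<lambda>s. h s $ i"]) simp
  qed
  moreover have "T * (a \<bullet> v 0) \<in> \<int>"
  proof (rule period_of_constant_speed_rotation[where \<gamma> = \<theta>])
    show "\<theta> T = \<theta> 0" using period[of 0] by (simp add: \<theta>_def)
    show "\<exists>c. c t = 0 \<and> (c has_vector_derivative a \<bullet> v 0) (at t) \<and>
        (\<forall>\<^sub>F s in nhds t. \<theta> s = circle_shift (\<theta> t) (c s))" for t
      using velocity[of t] by (auto simp: eventually_conj_iff const[of t])
  qed
  moreover have "T *\<^sub>R v 0 \<noteq> 0" using \<open>T > 0\<close> unit[of 0] by auto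
  ultimately show ?thesis by (intro exI[of _ "T *\<^sub>R v 0"]) auto
qed

text \<open>
  Orbits have unit speed on the torus, so the straight line in direction \<open>m\<close> takes time \<open>norm m\<close>
  to cover \<open>m\<close>; in that time \<open>\<theta>\<close> advances by \<open>a \<bullet> m\<close>, and all angles close up together.
\<close>

lemma integer_vector_imp_periodic_orbit:
  fixes a m :: "real ^ 'n"
  assumes "m \<noteq> 0" and m: "\<And>i. m $ i \<in> \<int>" and am: "a \<bullet> m \<in> \<int>"
  shows "flow_has_periodic_orbit (conf_manifold unit_tangent_torus)
     (standard_lee_field unit_tangent_torus torus_contact_form
        (torus_pullback (torus_constant_form a)))"
proof -
  let ?L = "standard_lee_field unit_tangent_torus torus_contact_form
     (torus_pullback (torus_constant_form a))"
  let ?M = "conf_manifold (unit_tangent_torus ::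
    ((circle ^ 'n) \<times> (real ^ 'n), (real ^ 'n) \<times> (real ^ 'n)) manifold)"
  define T v where "T = norm m" and "v = m /\<^sub>R norm m"
  have "T > 0" and unit: "norm v = 1" and Tv: "T *\<^sub>R v = m"
    using \<open>m \<noteq> 0\<close> by (simp_all add: T_def v_def)
  let ?z = "abs_circle 0"
  define \<gamma> where "\<gamma> t = (((\<chi> i. circle_shift ?z (t * v $ i)), v), circle_shift ?z (t * (a \<bullet> v)))" for t
  have "integral_curve ?M ?L \<gamma>"
    unfolding integral_curve_def
  proof
    fix t
    have "has_velocity ?M \<gamma> ((v, 0), a \<bullet> v) t"
      unfolding has_velocity_def
    proof (intro exI[of _ "\<lambda>s. (((s - t) *\<^sub>R v, 0), (s - t) * (a \<bullet> v))"] conjI)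
      show "((\<lambda>s. (((s - t) *\<^sub>R v, 0 :: real ^ 'n), (s - t) * (a \<bullet> v)))
          has_vector_derivative ((v, 0), a \<bullet> v)) (at t)"
        by (auto intro!: derivative_eq_intros has_vector_derivative_Pair)
      show "\<forall>\<^sub>F s in nhds t. \<gamma> s = shift ?M (\<gamma> t) (((s - t) *\<^sub>R v, 0), (s - t) * (a \<bullet> v))"
        by (simp add: \<gamma>_def shift_conf_torus circle_shift_shift algebra_simps)
    qed (simp add: zero_prod_def)
    then show "\<gamma> t \<in> points ?M \<and> has_velocity ?M \<gamma> (?L (\<gamma> t)) t"
      using standard_lee_field_torus[OF unit]
      by (simp add: \<gamma>_def unit conf_manifold_def unit_tangent_torus_def)
  qed
  moreover have "\<gamma> (t + T) = \<gamma> t" for t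
  proof -
    have "T * v $ i \<in> \<int>" for i using m[of i] Tv by (metis real_scaleR_def vector_scaleR_component)
    moreover have "T * (a \<bullet> v) \<in> \<int>" using am Tv by (metis inner_scaleR_right)
    ultimately show ?thesis
      by (simp add: \<gamma>_def distrib_right circle_shift_shift[symmetric] circle_shift_Ints)
  qed
  ultimately show ?thesis
    unfolding flow_has_periodic_orbit_def using \<open>T > 0\<close> by blast
qed

section \<open>Rational relations and integer vectors\<close>

lemma common_denominator:
  fixes q :: "'i \<Rightarrow> rat"
  assumes "finite A"
  shows "\<exists>N::int. N > 0 \<and> (\<forall>i\<in>A. of_int N * q i \<in> \<int>)"
  using assms
proof induction
  case empty
  show ?case by (rule exI[of _ 1]) simp
next
  case (insert j A)
  then obtain N :: int where N: "N > 0" "\<forall>i\<in>A. of_int N * q i \<in> \<int>" by blast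
  obtain b d where bd: "q j = of_int b / of_int d" "d > 0"
    by (metis quotient_of_denom_pos quotient_of_div surj_pair)
  have "of_int (d * N) * q i \<in> \<int>" if "i \<in> insert j A" for i
  proof (cases "i = j")
    case True
    have "of_int (d * N) * q j = of_int (N * b)" using bd by simp
    then show ?thesis using True by (metis Ints_of_int)
  next
    case False
    then have "of_int d * (of_int N * q i) \<in> \<int>" using that N(2) by (metis Ints_mult Ints_of_int insertE)
    then show ?thesis by (simp add: mult.assoc)
  qed
  moreover have "d * N > 0" using bd N by simp
  ultimately show ?case by blast
qed

lemma sum_option_UNIV:
  fixes f :: "'n::finite option \<Rightarrow> real"
  shows "(\<Sum>i\<in>UNIV. f i) = f None + (\<Sum>i\<in>UNIV. f (Some i))"
  by (simp add: UNIV_option_conv sum.reindex)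

lemma rationally_dependent_iff_integer_vector:
  fixes a :: "real ^ 'n"
  shows "\<not> rationally_independent (case_option 1 (\<lambda>i. a $ i)) \<longleftrightarrow>
    (\<exists>m::real^'n. m \<noteq> 0 \<and> (\<forall>i. m $ i \<in> \<int>) \<and> a \<bullet> m \<in> \<int>)"
proof
  assume "\<not> rationally_independent (case_option 1 (\<lambda>i. a $ i))"
  then obtain q :: "'n option \<Rightarrow> rat" and j where
    rel: "of_rat (q None) + (\<Sum>i\<in>UNIV. of_rat (q (Some i)) * a $ i) = 0" and j: "q j \<noteq> 0"
    unfolding rationally_independent_def sum_option_UNIV by auto
  obtain N :: int where N: "N > 0" "\<And>i. of_int N * q i \<in> \<int>"
    using common_denominator[of UNIV q] by auto
  have int: "of_int N * (of_rat (q i) :: real) \<in> \<int>" for i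
  proof -
    obtain k where "of_int N * q i = of_int k" using N(2)[of i] by (auto elim: Ints_cases)
    then have "(of_rat (of_int N * q i) :: real) = of_rat (of_int k)" by simp
    then show ?thesis by (simp add: of_rat_mult)
  qed
  define m :: "real ^ 'n" where "m = (\<chi> i. of_int N * of_rat (q (Some i)))"
  have am: "a \<bullet> m = - (of_int N * of_rat (q None))"
  proof -
    have "a \<bullet> m = of_int N * (\<Sum>i\<in>UNIV. of_rat (q (Some i)) * a $ i)"
      by (simp add: inner_vec_def m_def sum_distrib_left mult_ac)
    also have "(\<Sum>i\<in>UNIV. of_rat (q (Some i)) * a $ i) = - of_rat (q None)"
      using rel by simp
    finally show ?thesis by simp
  qed
  have "m \<noteq> 0"
  proof
    assume "m = 0"
    then have *: "q (Some i) = 0" for i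
      using N(1) by (simp add: m_def vec_eq_iff)
    with rel have "q None = 0" by simp
    with * j show False by (metis not_None_eq)
  qed
  moreover have "a \<bullet> m \<in> \<int>" unfolding am using int by simp
  ultimately show "\<exists>m::real^'n. m \<noteq> 0 \<and> (\<forall>i. m $ i \<in> \<int>) \<and> a \<bullet> m \<in> \<int>"
    using int by (intro exI[of _ m]) (simp add: m_def)
next
  assume "\<exists>m::real^'n. m \<noteq> 0 \<and> (\<forall>i. m $ i \<in> \<int>) \<and> a \<bullet> m \<in> \<int>"
  then obtain m :: "real^'n" where m: "m \<noteq> 0" "\<And>i. m $ i \<in> \<int>" "a \<bullet> m \<in> \<int>" by blast
  define q :: "'n option \<Rightarrow> rat" where
    "q = case_option (- of_int \<lfloor>a \<bullet> m\<rfloor>) (\<lambda>i. of_int \<lfloor>m $ i\<rfloor>)"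
  have floor: "of_int \<lfloor>m $ i\<rfloor> = m $ i" "of_int \<lfloor>a \<bullet> m\<rfloor> = a \<bullet> m" for i
    using m by (auto elim: Ints_cases)
  have "(\<Sum>i\<in>UNIV. of_rat (q i) * case_option 1 (\<lambda>i. a $ i) i) = 0"
    unfolding sum_option_UNIV
    by (simp add: q_def of_rat_minus floor) (simp add: inner_vec_def mult.commute)
  moreover obtain i where "q (Some i) \<noteq> 0"
  proof -
    obtain i where "m $ i \<noteq> 0" using m(1) by (auto simp: vec_eq_iff)
    then have "\<lfloor>m $ i\<rfloor> \<noteq> 0" using floor(1)[of i] by auto
    then show ?thesis using that[of i] by (simp add: q_def)
  qed
  ultimately show "\<not> rationally_independent (case_option 1 (\<lambda>i. a $ i))"
    unfolding rationally_independent_def by blast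
qed

theorem proposition16:
  fixes a :: "real ^ 'n"
  shows "\<not> flow_has_periodic_orbit
            (conf_manifold unit_tangent_torus)
            (standard_lee_field unit_tangent_torus torus_contact_form
              (torus_pullback (torus_constant_form a)))
         \<longleftrightarrow> rationally_independent (case_option 1 (\<lambda>i. a $ i))"
  using periodic_orbit_imp_integer_vector[of a] integer_vector_imp_periodic_orbit[of _ a]
    rationally_dependent_iff_integer_vector[of a] by blast

end
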